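(* Let $\varepsilon\in\{+1,-1\}$, let $N\ge 1$ be an integer, let $p$ be an integer with $0\le p<N$, and let $x\in\mathbb{R}$. For $0\le k<N$ put $c_k=k$ if $\varepsilon=+1$ and $c_k=k+\tfrac12$ if $\varepsilon=-1$, and put $a_k=\sin\left(\frac{2\pi}{N}c_k\right)$. Then $$\sum_{m=0}^{\infty}\varepsilon^m J_{Nm+p}(x)=\frac{\delta_{p0}}{2}J_0(x)+\frac{1}{2N}\sum_{k=0}^{N-1}\Bigg(\cos\left(\frac{2\pi}{N}pc_k-xa_k\right)+\cos\left(\frac{2\pi}{N}c_k\right)\bigg(J_{c_0}(a_k,x)\cos\left(\frac{2\pi}{N}pc_k-xa_k\right)+J_{s_0}(a_k,x)\sin\left(xa_k-\frac{2\pi}{N}pc_k\right)\bigg)\Bigg).$$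
   Context: $J_\nu$ denotes the Bessel function of the first kind of order $\nu$. $\delta_{ij}$ is the Kronecker delta. The infinite sum is the limit of the partial sums $\sum_{m=0}^{n}$ as $n\to\infty$. The incomplete Lipschitz-Hankel integrals of Bessel functions are defined by $$J_{c_0}(a,x)=\int_0^x\cos(at)J_0(t)\,dt,\qquad J_{s_0}(a,x)=\int_0^x\sin(at)J_0(t)\,dt$$ (here $c_0$ and $s_0$ in $J_{c_0},J_{s_0}$ are merely parts of the names of these functions, unrelated to the numbers $c_k$). *)

theory Defs
  imports "HOL-Analysis.Analysis"
begin

(* Bessel function of the first kind of integer order n \<ge> 0 at a real argument.
   For such n the factor 1 / Gamma (m + n + 1) of the usual power series is 1 / fact (m + n),
   and (x / 2) ^ (2 * m + n) is unambiguous for every real x, including x \<le> 0. *)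
definition Bessel_J :: "nat \<Rightarrow> real \<Rightarrow> real" where
  "Bessel_J n x = (\<Sum>m. (-1) ^ m / (fact m * fact (m + n)) * (x / 2) ^ (2 * m + n))"

(* The interval integrals below are oriented, so x < 0 is covered with the usual sign convention. *)
definition Lipschitz_Hankel_Jc0 :: "real \<Rightarrow> real \<Rightarrow> real" where
  "Lipschitz_Hankel_Jc0 a x = (LBINT t=0..ereal x. cos (a * t) * Bessel_J 0 t)"

definition Lipschitz_Hankel_Js0 :: "real \<Rightarrow> real \<Rightarrow> real" where
  "Lipschitz_Hankel_Js0 a x = (LBINT t=0..ereal x. sin (a * t) * Bessel_J 0 t)"

end

theory Submission
  imports Defs
begin

text \<open>
  Put \<open>\<theta>\<^sub>k = 2\<pi> c\<^sub>k / N\<close>. The points \<open>exp (i \<theta>\<^sub>k)\<close> are the \<open>N\<close>-th roots of \<open>\<epsilon>\<close>, so averaging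
  \<open>\<Sum>n. J\<^sub>n(x) cos (n \<theta>\<^sub>k - p \<theta>\<^sub>k)\<close> over \<open>k\<close> keeps exactly the indices \<open>n = N m + p\<close>, with weight
  \<open>\<epsilon>\<^sup>m\<close>. For fixed \<open>\<theta>\<close> and \<open>\<phi>\<close>, the recurrence \<open>2 J\<^sub>n' = J\<^sub>n\<^sub>-\<^sub>1 - J\<^sub>n\<^sub>+\<^sub>1\<close> makes
  \<open>H\<^sub>\<phi>(x) = (\<Sum>n. J\<^sub>n(x) cos (n \<theta> - \<phi>)) - J\<^sub>0(x) cos \<phi> / 2\<close> a solution of the linear system
  \<open>H\<^sub>\<phi>' = J\<^sub>0 cos \<theta> cos \<phi> / 2 - sin \<theta> H\<^sub>\<phi>\<^sub>+\<^sub>\<pi>\<^sub>/\<^sub>2\<close>. Rotating \<open>(H\<^sub>0, H\<^sub>\<pi>\<^sub>/\<^sub>2)\<close> by the angle \<open>x sin \<theta>\<close>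
  removes the homogeneous part, and the two components are then integrals of \<open>J\<^sub>0\<close> against
  \<open>cos (t sin \<theta>)\<close> and \<open>sin (t sin \<theta>)\<close>.
\<close>

text \<open>A separate majorant for each radius \<open>R\<close> suffices: the Weierstrass test is
  needed only on one bounded interval with \<open>x\<close> in its interior, and radius
  \<open>\<bar>x\<bar> + 1\<close> gives one.\<close>

lemma DERIV_suminf_locally_bounded:
  fixes f f' :: "nat \<Rightarrow> real \<Rightarrow> real" and M :: "real \<Rightarrow> nat \<Rightarrow> real"
  assumes deriv: "\<And>n y. (f n has_real_derivative f' n y) (at y)"
    and summable_f: "\<And>y. summable (\<lambda>n. f n y)"
    and bound: "\<And>R n y. \<bar>y\<bar> \<le> R \<Longrightarrow> \<bar>f' n y\<bar> \<le> M R n"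
    and summable_M: "\<And>R. summable (M R)"
  shows "((\<lambda>y. \<Sum>n. f n y) has_real_derivative (\<Sum>n. f' n x)) (at x)"
proof -
  define R where "R = \<bar>x\<bar> + 1"
  have "uniformly_convergent_on {-R..R} (\<lambda>n y. \<Sum>i<n. f' i y)"
  proof (rule Weierstrass_m_test'[where M = "M R"])
    show "norm (f' n y) \<le> M R n" if "y \<in> {-R..R}" for n y
      unfolding real_norm_def using that by (intro bound) (simp add: abs_le_iff)
  qed (rule summable_M)
  then show ?thesis
    by (rule has_field_derivative_series'(2)[rotated 2])
      (auto simp: R_def intro: has_field_derivative_at_within deriv summable_f)
qed

section \<open>Majorants and convergence of the power series of J_n\<close>

definition Bessel_term :: "nat \<Rightarrow> nat \<Rightarrow> real \<Rightarrow> real" where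
  "Bessel_term n m x = (-1) ^ m / (fact m * fact (m + n)) * (x / 2) ^ (2 * m + n)"

text \<open>Since \<open>fact (m + n) \<ge> fact n\<close>, the power series is dominated by an
  exponential series in \<open>m\<close>. The remaining factor \<open>(R / 2) ^ n / fact n\<close>
  is summable in \<open>n\<close>, so the same bound controls series over the order.\<close>

definition Bessel_bound :: "nat \<Rightarrow> real \<Rightarrow> real" where
  "Bessel_bound n R = (R / 2) ^ n / fact n * exp ((R / 2)\<^sup>2)"

lemma abs_Bessel_term_le:
  assumes "\<bar>x\<bar> \<le> R"
  shows "\<bar>Bessel_term n m x\<bar> \<le> (R / 2) ^ n / fact n * (((R / 2)\<^sup>2) ^ m / fact m)"
proof -
  have "\<bar>Bessel_term n m x\<bar> = \<bar>x / 2\<bar> ^ (2 * m + n) / (fact m * fact (m + n))"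
    by (simp add: Bessel_term_def abs_mult power_abs)
  also have "\<dots> \<le> (R / 2) ^ (2 * m + n) / (fact m * fact n)"
    using assms by (intro frac_le power_mono mult_left_mono fact_mono) auto
  finally show ?thesis
    by (simp only: power_add power_mult) (simp add: mult.commute)
qed

lemma sums_exp_real: "(\<lambda>m. y ^ m / fact m) sums exp y" for y :: real
  using exp_converges[of y] by (simp add: field_simps)

lemma Bessel_bound_sums:
  "(\<lambda>m. (R / 2) ^ n / fact n * (((R / 2)\<^sup>2) ^ m / fact m)) sums Bessel_bound n R"
  unfolding Bessel_bound_def by (intro sums_mult sums_exp_real)

lemma summable_Bessel_bound: "summable (\<lambda>n. Bessel_bound n R)"
  unfolding Bessel_bound_def by (intro summable_mult2 sums_summable[OF sums_exp_real])

lemma summable_abs_Bessel_term: "summable (\<lambda>m. \<bar>Bessel_term n m x\<bar>)"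
  by (rule summable_comparison_test'[OF sums_summable[OF Bessel_bound_sums], of 0])
    (use abs_Bessel_term_le[of x "\<bar>x\<bar>"] in simp)

lemma Bessel_term_sums: "(\<lambda>m. Bessel_term n m x) sums Bessel_J n x"
  using summable_sums[OF summable_rabs_cancel[OF summable_abs_Bessel_term]]
  by (simp add: Bessel_J_def Bessel_term_def)

lemma abs_Bessel_J_le:
  assumes "\<bar>x\<bar> \<le> R"
  shows "\<bar>Bessel_J n x\<bar> \<le> Bessel_bound n R"
proof -
  have "\<bar>Bessel_J n x\<bar> \<le> (\<Sum>m. \<bar>Bessel_term n m x\<bar>)"
    using summable_rabs[OF summable_abs_Bessel_term] sums_unique[OF Bessel_term_sums] by metis
  also have "\<dots> \<le> Bessel_bound n R"
    using abs_Bessel_term_le[OF assms] summable_abs_Bessel_term Bessel_bound_sums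
    by (metis (no_types, lifting) suminf_le sums_summable sums_unique)
  finally show ?thesis .
qed

lemma summable_Bessel_J_weighted:
  assumes "\<And>n. \<bar>w n\<bar> \<le> 1"
  shows "summable (\<lambda>n. Bessel_J n x * w n)"
proof (rule summable_comparison_test'[OF summable_Bessel_bound, of 0])
  fix n
  show "norm (Bessel_J n x * w n) \<le> Bessel_bound n \<bar>x\<bar>"
    using mult_mono[OF abs_Bessel_J_le[of x "\<bar>x\<bar>" n] assms[of n]]
    by (simp add: abs_mult Bessel_bound_def)
qed

lemma Bessel_J_at_0: "Bessel_J n 0 = (if n = 0 then 1 else 0)"
proof -
  have "Bessel_term n m 0 = (if m = 0 then if n = 0 then 1 else 0 else 0)" for m
    by (simp add: Bessel_term_def)
  then show ?thesis
    using sums_unique2[OF Bessel_term_sums[of n 0]] sums_single[of 0 "\<lambda>_. if n = 0 then 1 else 0 :: real"]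
    by simp
qed

section \<open>Derivatives of J_n\<close>

definition Bessel_term_shift :: "nat \<Rightarrow> nat \<Rightarrow> real \<Rightarrow> real" where
  "Bessel_term_shift n m x = (case m of 0 \<Rightarrow> 0 | Suc l \<Rightarrow> Bessel_term n l x)"

text \<open>In the derivative of the \<open>m\<close>-th term, a factor \<open>m\<close> cancels
  against \<open>fact m\<close> and leaves the term of index \<open>m - 1\<close> of the next higher
  order. Delaying that series by one place, with 0 in front, allows comparison index by index and
  keeps the sum.\<close>

lemma Bessel_term_shift_sums: "(\<lambda>m. Bessel_term_shift n m x) sums Bessel_J n x"
proof -
  have "(\<lambda>m. Bessel_term_shift n (Suc m) x) sums Bessel_J n x"
    using Bessel_term_sums by (simp add: Bessel_term_shift_def)
  then show ?thesis
    by (subst (asm) sums_Suc_iff) (simp add: Bessel_term_shift_def)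
qed

definition Bessel_shift_bound :: "nat \<Rightarrow> real \<Rightarrow> nat \<Rightarrow> real" where
  "Bessel_shift_bound n R m =
    (case m of 0 \<Rightarrow> 0 | Suc l \<Rightarrow> (R / 2) ^ n / fact n * (((R / 2)\<^sup>2) ^ l / fact l))"

lemma summable_Bessel_shift_bound: "summable (Bessel_shift_bound n R)"
proof -
  have "summable (\<lambda>m. Bessel_shift_bound n R (Suc m))"
    using sums_summable[OF Bessel_bound_sums] by (simp add: Bessel_shift_bound_def)
  then show ?thesis by (subst (asm) summable_Suc_iff)
qed

lemma abs_Bessel_term_shift_le:
  "\<bar>x\<bar> \<le> R \<Longrightarrow> \<bar>Bessel_term_shift n m x\<bar> \<le> Bessel_shift_bound n R m"
  using abs_Bessel_term_le by (auto simp: Bessel_term_shift_def Bessel_shift_bound_def split: nat.split)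

lemma DERIV_half_power:
  fixes c x :: real
  shows "((\<lambda>x. c * (x / 2) ^ k) has_real_derivative c * (real k * (x / 2) ^ (k - 1) * (1 / 2))) (at x)"
  by (auto intro!: derivative_eq_intros)

lemma DERIV_Bessel_term_0:
  "(Bessel_term 0 m has_real_derivative - Bessel_term_shift (Suc 0) m x) (at x)"
proof (cases m)
  case 0
  then show ?thesis by (simp add: Bessel_term_def[abs_def] Bessel_term_shift_def)
next
  case (Suc l)
  have "(Bessel_term 0 m has_real_derivative
      (-1) ^ m / (fact m * fact m) * (real (2 * m) * (x / 2) ^ (2 * m - 1) * (1 / 2))) (at x)"
    using DERIV_half_power[of _ "2 * m"] by (simp only: Bessel_term_def[abs_def] add_0_right)
  also have "(-1) ^ m / (fact m * fact m) * (real (2 * m) * (x / 2) ^ (2 * m - 1) * (1 / 2))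
      = - Bessel_term_shift (Suc 0) m x"
    unfolding Suc by (simp add: Bessel_term_def Bessel_term_shift_def divide_simps)
  finally show ?thesis .
qed

lemma DERIV_Bessel_term_Suc:
  "(Bessel_term (Suc n) m has_real_derivative
    (Bessel_term n m x - Bessel_term_shift (Suc (Suc n)) m x) / 2) (at x)"
proof -
  have *: "(Bessel_term (Suc n) m has_real_derivative
      (-1) ^ m / (fact m * fact (m + Suc n)) * (real (2 * m + Suc n) * (x / 2) ^ (2 * m + n) * (1 / 2))) (at x)"
    using DERIV_half_power[of _ "2 * m + Suc n"]
    by (simp only: Bessel_term_def[abs_def] add_Suc_right diff_Suc_1)
  \<comment> \<open>Split the factor \<open>2 m + n + 1\<close> as \<open>m + (m + n + 1)\<close> and cancel each part against a factorial.\<close>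
  have split: "u * (real (2 * m + Suc n) * z * (1 / 2)) = (u * (real (m + Suc n) * z) + u * (real m * z)) / 2"
    for u z :: real by (simp add: algebra_simps)
  have "(-1) ^ m / (fact m * fact (m + Suc n)) * (real (m + Suc n) * (x / 2) ^ (2 * m + n)) =
      Bessel_term n m x"
    by (simp add: Bessel_term_def divide_simps del: of_nat_add of_nat_Suc)
  moreover have "(-1) ^ m / (fact m * fact (m + Suc n)) * (real m * (x / 2) ^ (2 * m + n)) =
      - Bessel_term_shift (Suc (Suc n)) m x"
    by (cases m) (simp_all add: Bessel_term_def Bessel_term_shift_def divide_simps del: of_nat_add of_nat_Suc)
  ultimately have "(-1) ^ m / (fact m * fact (m + Suc n)) * (real (2 * m + Suc n) * (x / 2) ^ (2 * m + n) * (1 / 2))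
      = (Bessel_term n m x - Bessel_term_shift (Suc (Suc n)) m x) / 2"
    unfolding split by simp
  with * show ?thesis by (simp only:)
qed

lemma abs_half_diff_le:
  fixes u v :: real
  shows "\<bar>u\<bar> \<le> U \<Longrightarrow> \<bar>v\<bar> \<le> V \<Longrightarrow> \<bar>(u - v) / 2\<bar> \<le> (U + V) / 2"
  by (auto simp: abs_le_iff)

lemma Bessel_J_eq_suminf: "Bessel_J n = (\<lambda>x. \<Sum>m. Bessel_term n m x)"
  using sums_unique[OF Bessel_term_sums] by blast

lemma DERIV_Bessel_J_0: "(Bessel_J 0 has_real_derivative - Bessel_J (Suc 0) x) (at x)"
proof -
  have "((\<lambda>x. \<Sum>m. Bessel_term 0 m x) has_real_derivative (\<Sum>m. - Bessel_term_shift (Suc 0) m x)) (at x)"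
    by (rule DERIV_suminf_locally_bounded[where M = "Bessel_shift_bound (Suc 0)"])
      (auto intro: DERIV_Bessel_term_0 abs_Bessel_term_shift_le summable_Bessel_shift_bound
        sums_summable[OF Bessel_term_sums])
  then show ?thesis
    using sums_unique[OF sums_minus[OF Bessel_term_shift_sums[of "Suc 0" x]]]
    by (simp add: Bessel_J_eq_suminf[of 0])
qed

lemma DERIV_Bessel_J_Suc:
  "(Bessel_J (Suc n) has_real_derivative (Bessel_J n x - Bessel_J (Suc (Suc n)) x) / 2) (at x)"
proof -
  have "((\<lambda>x. \<Sum>m. Bessel_term (Suc n) m x) has_real_derivative
      (\<Sum>m. (Bessel_term n m x - Bessel_term_shift (Suc (Suc n)) m x) / 2)) (at x)"
  proof (rule DERIV_suminf_locally_bounded[where M =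
        "\<lambda>R m. ((R / 2) ^ n / fact n * (((R / 2)\<^sup>2) ^ m / fact m) + Bessel_shift_bound (Suc (Suc n)) R m) / 2"])
    show "\<bar>(Bessel_term n m y - Bessel_term_shift (Suc (Suc n)) m y) / 2\<bar> \<le>
        ((R / 2) ^ n / fact n * (((R / 2)\<^sup>2) ^ m / fact m) + Bessel_shift_bound (Suc (Suc n)) R m) / 2"
      if "\<bar>y\<bar> \<le> R" for R m y
      by (intro abs_half_diff_le abs_Bessel_term_le abs_Bessel_term_shift_le that)
    show "summable (\<lambda>m. ((R / 2) ^ n / fact n * (((R / 2)\<^sup>2) ^ m / fact m)
        + Bessel_shift_bound (Suc (Suc n)) R m) / 2)" for R
      by (intro summable_divide summable_add summable_Bessel_shift_bound
          sums_summable[OF Bessel_bound_sums])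
  qed (auto intro: DERIV_Bessel_term_Suc sums_summable[OF Bessel_term_sums])
  then show ?thesis
    using sums_unique[OF sums_divide[OF sums_diff[OF Bessel_term_sums[of n x]
            Bessel_term_shift_sums[of "Suc (Suc n)" x]], of 2]]
    by (simp add: Bessel_J_eq_suminf[of "Suc n"])
qed

section \<open>The trigonometric Bessel series and its differential equation\<close>

text \<open>The function \<open>H\<^sub>\<phi>\<close>; the halved \<open>J\<^sub>0\<close> term makes the \<open>J\<^sub>1\<close> terms of the derivative cancel.\<close>

definition Bessel_series :: "real \<Rightarrow> real \<Rightarrow> real \<Rightarrow> real" where
  "Bessel_series \<theta> \<phi> x =
    Bessel_J 0 x * cos \<phi> / 2 + (\<Sum>n. Bessel_J (Suc n) x * cos (real (Suc n) * \<theta> - \<phi>))"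

lemma summable_Bessel_J_Suc_weighted:
  assumes "\<And>n. \<bar>w n\<bar> \<le> 1"
  shows "summable (\<lambda>n. Bessel_J (Suc n) x * w n)"
  \<comment> \<open>At \<open>n = 0\<close> truncated subtraction gives \<open>w 0\<close>, a
    bounded weight for the term that the index shift then drops.\<close>
  using summable_Bessel_J_weighted[of "\<lambda>n. w (n - 1)" x, OF assms]
    summable_Suc_iff[of "\<lambda>n. Bessel_J n x * w (n - 1)"]
  by simp

text \<open>\<open>Bessel_series\<close> holds only half of the \<open>n = 0\<close> term. The other
  half is the source of the Kronecker delta in the final formula.\<close>

lemma Bessel_J_cos_sums:
  "(\<lambda>n. Bessel_J n x * cos (real n * \<theta> - \<phi>)) sums (Bessel_J 0 x * cos \<phi> / 2 + Bessel_series \<theta> \<phi> x)"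
proof -
  have "(\<lambda>n. Bessel_J (Suc n) x * cos (real (Suc n) * \<theta> - \<phi>)) sums
      (\<Sum>n. Bessel_J (Suc n) x * cos (real (Suc n) * \<theta> - \<phi>))"
    by (intro summable_sums summable_Bessel_J_Suc_weighted) auto
  then show ?thesis
    by (subst (asm) sums_Suc_iff) (simp add: Bessel_series_def algebra_simps)
qed

lemma Bessel_series_at_0: "Bessel_series \<theta> \<phi> 0 = cos \<phi> / 2"
  by (simp add: Bessel_series_def Bessel_J_at_0)

text \<open>The addition formula makes the series linear in \<open>cos \<phi>\<close> and
  \<open>sin \<phi>\<close>. So the phases 0 and \<open>pi / 2\<close> determine all others, and the
  system for these two is closed: a further quarter turn gives phase \<open>pi\<close>, which is
  minus phase 0.\<close>

lemma Bessel_series_decompose: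
  "Bessel_series \<theta> \<phi> x = cos \<phi> * Bessel_series \<theta> 0 x + sin \<phi> * Bessel_series \<theta> (pi / 2) x"
proof -
  have "(\<lambda>n. Bessel_J n x * cos (real n * \<theta> - \<phi>)) =
      (\<lambda>n. cos \<phi> * (Bessel_J n x * cos (real n * \<theta> - 0)) + sin \<phi> * (Bessel_J n x * cos (real n * \<theta> - pi / 2)))"
    by (simp add: cos_diff algebra_simps)
  then have "Bessel_J 0 x * cos \<phi> / 2 + Bessel_series \<theta> \<phi> x =
      cos \<phi> * (Bessel_J 0 x * cos 0 / 2 + Bessel_series \<theta> 0 x) +
      sin \<phi> * (Bessel_J 0 x * cos (pi / 2) / 2 + Bessel_series \<theta> (pi / 2) x)"
    by (intro sums_unique2[OF Bessel_J_cos_sums])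
      (simp only: sums_add sums_mult Bessel_J_cos_sums)
  then show ?thesis by (simp add: algebra_simps)
qed

lemma Bessel_series_shift_pi: "Bessel_series \<theta> pi x = - Bessel_series \<theta> 0 x"
  by (simp add: Bessel_series_decompose[of \<theta> pi])

text \<open>Regrouping the differentiated series by order leaves weights two steps apart on each
  Bessel function. Their difference is a product of sines, which is the original weight with its
  phase moved by \<open>pi / 2\<close>, times \<open>- 2 * sin \<theta>\<close>.\<close>

lemma DERIV_Bessel_series:
  "(Bessel_series \<theta> \<phi> has_real_derivative
    Bessel_J 0 x * cos \<theta> * cos \<phi> / 2 - sin \<theta> * Bessel_series \<theta> (\<phi> + pi / 2) x) (at x)"
proof -
  define w where "w n = cos (real n * \<theta> - \<phi>)" for n
  have w_le: "\<bar>w n\<bar> \<le> 1" for n by (simp add: w_def)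
  have deriv_sum: "((\<lambda>y. \<Sum>n. Bessel_J (Suc n) y * w (Suc n)) has_real_derivative
      (\<Sum>n. (Bessel_J n x - Bessel_J (Suc (Suc n)) x) / 2 * w (Suc n))) (at x)"
  proof (rule DERIV_suminf_locally_bounded[where M =
        "\<lambda>R n. (Bessel_bound n R + Bessel_bound (Suc (Suc n)) R) / 2"])
    show "\<bar>(Bessel_J n y - Bessel_J (Suc (Suc n)) y) / 2 * w (Suc n)\<bar> \<le>
        (Bessel_bound n R + Bessel_bound (Suc (Suc n)) R) / 2"
      if "\<bar>y\<bar> \<le> R" for R n y
    proof -
      have "\<bar>(Bessel_J n y - Bessel_J (Suc (Suc n)) y) / 2 * w (Suc n)\<bar> \<le>
          \<bar>(Bessel_J n y - Bessel_J (Suc (Suc n)) y) / 2\<bar> * 1"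
        unfolding abs_mult by (intro mult_left_mono w_le) auto
      also have "\<dots> \<le> (Bessel_bound n R + Bessel_bound (Suc (Suc n)) R) / 2"
        unfolding mult_1_right by (intro abs_half_diff_le abs_Bessel_J_le that)
      finally show ?thesis .
    qed
    show "summable (\<lambda>n. (Bessel_bound n R + Bessel_bound (Suc (Suc n)) R) / 2)" for R
      by (intro summable_divide summable_add)
        (simp_all add: summable_Suc_iff[of "\<lambda>n. Bessel_bound (Suc n) R"]
          summable_Suc_iff[of "\<lambda>n. Bessel_bound n R"] summable_Bessel_bound)
    show "summable (\<lambda>n. Bessel_J (Suc n) y * w (Suc n))" for y
      by (intro summable_Bessel_J_Suc_weighted w_le)
  qed (auto intro!: derivative_eq_intros DERIV_Bessel_J_Suc)
  define X where "X = (\<Sum>n. Bessel_J (Suc n) x * w (Suc (Suc n)))"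
  define Y where "Y = (\<Sum>n. Bessel_J (Suc n) x * w n)"
  have X: "(\<lambda>n. Bessel_J (Suc n) x * w (Suc (Suc n))) sums X"
    and Y: "(\<lambda>n. Bessel_J (Suc n) x * w n) sums Y"
    unfolding X_def Y_def by (intro summable_sums summable_Bessel_J_Suc_weighted w_le)+
  \<comment> \<open>Aligning the orders costs boundary terms: the first series starts one order
    earlier than \<open>X\<close> and gains \<open>J_0\<close>, while the second starts one order
    later than \<open>Y\<close> and loses \<open>J_1\<close>.\<close>
  have "(\<lambda>n. Bessel_J n x * w (Suc n)) sums (X + Bessel_J 0 x * w 1)"
    using X by (subst (asm) sums_Suc_iff[where f = "\<lambda>n. Bessel_J n x * w (Suc n)"]) simp
  moreover have "(\<lambda>n. Bessel_J (Suc (Suc n)) x * w (Suc n)) sums (Y - Bessel_J 1 x * w 0)"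
    using Y by (subst sums_Suc_iff[where f = "\<lambda>n. Bessel_J (Suc n) x * w n"]) simp
  ultimately have
    "(\<lambda>n. (Bessel_J n x * w (Suc n) - Bessel_J (Suc (Suc n)) x * w (Suc n)) / 2) sums
      ((X + Bessel_J 0 x * w 1 - (Y - Bessel_J 1 x * w 0)) / 2)"
    by (intro sums_divide sums_diff)
  then have sum_eq: "(\<Sum>n. (Bessel_J n x - Bessel_J (Suc (Suc n)) x) / 2 * w (Suc n)) =
      (X - Y + Bessel_J 0 x * w 1 + Bessel_J 1 x * w 0) / 2"
    by (simp add: sums_iff algebra_simps diff_divide_distrib)
  have w_diff: "w (Suc (Suc n)) - w n = - 2 * sin \<theta> * cos (real (Suc n) * \<theta> - (\<phi> + pi / 2))" for n
  proof -
    have "w (Suc (Suc n)) = cos ((real (Suc n) * \<theta> - \<phi>) + \<theta>)" "w n = cos ((real (Suc n) * \<theta> - \<phi>) - \<theta>)"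
      by (simp_all add: w_def algebra_simps)
    moreover have "cos (real (Suc n) * \<theta> - (\<phi> + pi / 2)) = sin (real (Suc n) * \<theta> - \<phi>)"
      by (simp only: diff_diff_eq[symmetric]) (simp add: cos_diff)
    ultimately show ?thesis by (simp only: cos_add cos_diff) simp
  qed
  define Z where "Z = (\<Sum>n. Bessel_J (Suc n) x * cos (real (Suc n) * \<theta> - (\<phi> + pi / 2)))"
  have "(\<lambda>n. Bessel_J (Suc n) x * cos (real (Suc n) * \<theta> - (\<phi> + pi / 2))) sums Z"
    unfolding Z_def by (intro summable_sums summable_Bessel_J_Suc_weighted) auto
  from sums_mult[OF this, of "- 2 * sin \<theta>"] sums_diff[OF X Y]
  have XY: "X - Y = - 2 * sin \<theta> * Z"
    by (intro sums_unique2[of "\<lambda>n. Bessel_J (Suc n) x * (w (Suc (Suc n)) - w n)"])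
      (simp_all only: w_diff[symmetric] right_diff_distrib mult.left_commute[of "- 2 * sin \<theta>"])
  have shift: "cos (\<phi> + pi / 2) = - sin \<phi>"
    by (simp add: cos_add)
  have "(Bessel_series \<theta> \<phi> has_real_derivative
      - Bessel_J 1 x * cos \<phi> / 2 + (X - Y + Bessel_J 0 x * w 1 + Bessel_J 1 x * w 0) / 2) (at x)"
    unfolding Bessel_series_def[abs_def] w_def[symmetric]
    using deriv_sum unfolding sum_eq
    by (auto intro!: derivative_eq_intros DERIV_Bessel_J_0)
  \<comment> \<open>As \<open>w 0 = cos \<phi>\<close>, the \<open>J_1\<close> terms cancel. In
    \<open>w 1 = cos (\<theta> - \<phi>)\<close> the part \<open>sin \<theta> * sin \<phi>\<close>
    is the halved \<open>J_0\<close> term of the series with phase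
    \<open>\<phi> + pi / 2\<close>.\<close>
  moreover have "- Bessel_J 1 x * cos \<phi> / 2 + (X - Y + Bessel_J 0 x * w 1 + Bessel_J 1 x * w 0) / 2 =
      Bessel_J 0 x * cos \<theta> * cos \<phi> / 2 - sin \<theta> * Bessel_series \<theta> (\<phi> + pi / 2) x"
    unfolding XY Bessel_series_def Z_def[symmetric] shift by (simp add: w_def cos_diff field_simps)
  ultimately show ?thesis by simp
qed

section \<open>Integration of the rotated system\<close>

lemma isCont_Bessel_J_0: "isCont (Bessel_J 0) x"
  using DERIV_Bessel_J_0 by (rule DERIV_isCont)

lemma interval_integral_FTC_from_0:
  fixes F f :: "real \<Rightarrow> real"
  assumes "\<And>t. (F has_real_derivative f t) (at t)" and "\<And>t. isCont f t"
  shows "(LBINT t=0..ereal x. f t) = F x - F 0"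
proof -
  \<comment> \<open>The finite form of the fundamental theorem takes endpoints in either order, so
    negative \<open>x\<close> needs no separate case.\<close>
  have "(LBINT t=ereal 0..ereal x. f t) = F x - F 0"
    by (rule interval_integral_FTC_finite)
      (auto intro!: continuous_at_imp_continuous_on assms
        simp flip: has_real_derivative_iff_has_vector_derivative
        intro: has_field_derivative_at_within)
  then show ?thesis by (simp add: zero_ereal_def)
qed

text \<open>Writing A, B for the series with phases 0 and \<open>pi / 2\<close>, one has A' = J_0
  cos(theta)/2 - sin(theta) B and B' = sin(theta) A. In the derivative of the left side the terms
  with A and B cancel and only J_0 remains; 1/2 is the initial value A(0).\<close>

lemma Bessel_series_rotate_cos:
  "Bessel_series \<theta> 0 x * cos (x * sin \<theta>) + Bessel_series \<theta> (pi / 2) x * sin (x * sin \<theta>) =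
    1 / 2 + cos \<theta> / 2 * Lipschitz_Hankel_Jc0 (sin \<theta>) x"
proof -
  have "(LBINT t=0..ereal x. cos \<theta> / 2 * (cos (sin \<theta> * t) * Bessel_J 0 t)) =
      (\<lambda>x. Bessel_series \<theta> 0 x * cos (x * sin \<theta>) + Bessel_series \<theta> (pi / 2) x * sin (x * sin \<theta>)) x -
      (\<lambda>x. Bessel_series \<theta> 0 x * cos (x * sin \<theta>) + Bessel_series \<theta> (pi / 2) x * sin (x * sin \<theta>)) 0"
    by (rule interval_integral_FTC_from_0)
      (auto intro!: derivative_eq_intros DERIV_Bessel_series continuous_intros isCont_Bessel_J_0
        simp: Bessel_series_shift_pi algebra_simps)
  then show ?thesis
    by (simp add: Lipschitz_Hankel_Jc0_def Bessel_series_at_0 algebra_simps)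
qed

lemma Bessel_series_rotate_sin:
  "Bessel_series \<theta> 0 x * sin (x * sin \<theta>) - Bessel_series \<theta> (pi / 2) x * cos (x * sin \<theta>) =
    cos \<theta> / 2 * Lipschitz_Hankel_Js0 (sin \<theta>) x"
proof -
  have "(LBINT t=0..ereal x. cos \<theta> / 2 * (sin (sin \<theta> * t) * Bessel_J 0 t)) =
      (\<lambda>x. Bessel_series \<theta> 0 x * sin (x * sin \<theta>) - Bessel_series \<theta> (pi / 2) x * cos (x * sin \<theta>)) x -
      (\<lambda>x. Bessel_series \<theta> 0 x * sin (x * sin \<theta>) - Bessel_series \<theta> (pi / 2) x * cos (x * sin \<theta>)) 0"
    by (rule interval_integral_FTC_from_0)
      (auto intro!: derivative_eq_intros DERIV_Bessel_series continuous_intros isCont_Bessel_J_0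
        simp: Bessel_series_shift_pi algebra_simps)
  then show ?thesis
    by (simp add: Lipschitz_Hankel_Js0_def Bessel_series_at_0 algebra_simps)
qed

lemma Bessel_series_closed_form:
  "Bessel_series \<theta> \<phi> x = 1 / 2 * (cos (\<phi> - x * sin \<theta>) + cos \<theta> *
    (Lipschitz_Hankel_Jc0 (sin \<theta>) x * cos (\<phi> - x * sin \<theta>) +
     Lipschitz_Hankel_Js0 (sin \<theta>) x * sin (x * sin \<theta> - \<phi>)))"
proof -
  define A B s where "A = Bessel_series \<theta> 0 x" and "B = Bessel_series \<theta> (pi / 2) x" and "s = x * sin \<theta>"
  \<comment> \<open>The map from (A, B) to (A cos s + B sin s, A sin s - B cos s) is orthogonal and
    sends (cos phi, sin phi) to (cos(phi - s), sin(s - phi)). The identity says that it preserves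
    the inner product of these two vectors.\<close>
  have rotation: "cos \<phi> * A + sin \<phi> * B =
      (A * cos s + B * sin s) * cos (\<phi> - s) + (A * sin s - B * cos s) * sin (s - \<phi>)"
  proof -
    have "(A * cos s + B * sin s) * cos (\<phi> - s) + (A * sin s - B * cos s) * sin (s - \<phi>) =
        (cos \<phi> * A + sin \<phi> * B) * ((sin s)\<^sup>2 + (cos s)\<^sup>2)"
      unfolding cos_diff sin_diff by algebra
    then show ?thesis by simp
  qed
  show ?thesis
    unfolding Bessel_series_decompose[of \<theta> \<phi>] rotation[unfolded A_def B_def s_def]
      Bessel_series_rotate_cos Bessel_series_rotate_sin
    by (simp add: algebra_simps)
qed

section \<open>Averages over the N-th roots of epsilon\<close>

lemma cis_eq_1_imp_int:
  assumes "cis (2 * pi * r) = 1"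
  shows "r \<in> \<int>"
proof -
  have "cos (2 * pi * r) = 1"
    using assms by (metis cis.sel(1) one_complex.sel(1))
  then obtain m :: int where "2 * pi * r = of_int m * 2 * pi"
    using cos_one_2pi_int by auto
  then show ?thesis by simp
qed

text \<open>This is the real part of a geometric sum whose ratio is an \<open>N\<close>-th root of
  unity other than 1; the offset \<open>b\<close> contributes only a common phase factor.\<close>

lemma sum_cos_equidistant_eq_0:
  fixes d :: int and N :: nat and b :: real
  assumes "N \<ge> 1" "\<not> int N dvd d"
  shows "(\<Sum>k<N. cos (of_int d * (2 * pi / real N * (real k + b)))) = 0"
proof -
  define z where "z = cis (2 * pi * (of_int d / real N))"
  have "z \<noteq> 1"
  proof
    assume "z = 1"
    then obtain m where "of_int d / real N = (of_int m :: real)"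
      unfolding z_def by (meson Ints_cases cis_eq_1_imp_int)
    then have "(of_int d :: real) = of_int (m * int N)"
      using assms(1) by (simp add: field_simps)
    then show False
      using assms(2) by (metis dvd_triv_right of_int_eq_iff)
  qed
  have "z ^ N = cis (2 * pi * of_int d)"
    unfolding z_def Complex.DeMoivre using assms(1) by simp
  also have "\<dots> = 1"
    using cis_multiple_2pi by auto
  finally have "(\<Sum>k<N. z ^ k) = 0"
    using \<open>z \<noteq> 1\<close> by (simp add: geometric_sum)
  moreover have "cis (of_int d * (2 * pi / real N * (real k + b))) =
      cis (of_int d * (2 * pi / real N * b)) * z ^ k" for k
    by (simp add: z_def Complex.DeMoivre cis_mult distrib_left add_divide_distrib ac_simps)
  ultimately have "(\<Sum>k<N. cis (of_int d * (2 * pi / real N * (real k + b)))) = 0"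
    by (simp flip: sum_distrib_left)
  then have "Re (\<Sum>k<N. cis (of_int d * (2 * pi / real N * (real k + b)))) = 0"
    by simp
  then show ?thesis by simp
qed

lemma sum_cos_roots:
  fixes \<epsilon> :: real and N p n :: nat and \<theta> :: "nat \<Rightarrow> real"
  assumes \<epsilon>: "\<epsilon> \<in> {1, -1}" and "N \<ge> 1" and "p < N"
    and \<theta>: "\<And>k. k < N \<Longrightarrow> \<theta> k = 2 * pi / real N * (if \<epsilon> = 1 then real k else real k + 1 / 2)"
  shows "n \<notin> range (\<lambda>m. N * m + p) \<Longrightarrow> (\<Sum>k<N. cos (real n * \<theta> k - real p * \<theta> k)) = 0"
    and "(\<Sum>k<N. cos (real (N * m + p) * \<theta> k - real p * \<theta> k)) = real N * \<epsilon> ^ m"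
proof -
  define b :: real where "b = (if \<epsilon> = 1 then 0 else 1 / 2)"
  have \<theta>_eq: "\<theta> k = 2 * pi / real N * (real k + b)" if "k < N" for k
    using \<theta>[OF that] by (simp add: b_def)
  {
    assume n: "n \<notin> range (\<lambda>m. N * m + p)"
    have "\<not> int N dvd int n - int p"
    proof
      assume "int N dvd int n - int p"
      \<comment> \<open>Because \<open>p < N\<close>, the residue of \<open>p\<close> is
        \<open>p\<close> itself; this also excludes a congruent \<open>n\<close> below
        \<open>p\<close>.\<close>
      then have "n mod N = p"
        using \<open>p < N\<close> by (metis mod_eq_dvd_iff mod_less of_nat_eq_iff of_nat_mod)
      then have "n = N * (n div N) + p"
        using mult_div_mod_eq[of N n] by simp
      with n show False by blast
    qed
    note sum_cos_equidistant_eq_0[OF \<open>N \<ge> 1\<close> this, of b]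
    moreover have "(\<Sum>k<N. cos (real n * \<theta> k - real p * \<theta> k)) =
        (\<Sum>k<N. cos (of_int (int n - int p) * (2 * pi / real N * (real k + b))))"
      by (intro sum.cong refl) (simp only: \<theta>_eq lessThan_iff left_diff_distrib of_int_diff of_int_of_nat_eq)
    ultimately show "(\<Sum>k<N. cos (real n * \<theta> k - real p * \<theta> k)) = 0"
      by (simp only:)
  next
    have "cos (real (N * m + p) * \<theta> k - real p * \<theta> k) = \<epsilon> ^ m" if "k < N" for k
    proof -
      \<comment> \<open>Modulo full turns only the offset survives: the angle is 0 for
        \<open>b = 0\<close> and \<open>m * pi\<close> for \<open>b = 1 / 2\<close>, with cosine
        \<open>\<epsilon> ^ m\<close> in both cases.\<close>
      have "real (N * m + p) * \<theta> k - real p * \<theta> k = (2 * real m * b) * pi + 2 * real (m * k) * pi"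
        using \<open>N \<ge> 1\<close> by (simp add: \<theta>_eq[OF that] field_simps)
      then have "cos (real (N * m + p) * \<theta> k - real p * \<theta> k) = cos ((2 * real m * b) * pi)"
        by (simp only: cos_add cos_2npi sin_2npi mult_1_right mult_zero_right diff_0_right)
      then show ?thesis
        using \<epsilon> by (auto simp: b_def)
    qed
    then show "(\<Sum>k<N. cos (real (N * m + p) * \<theta> k - real p * \<theta> k)) = real N * \<epsilon> ^ m"
      by simp
  }
qed

theorem theorem5:
  fixes \<epsilon> :: real and N p :: nat and x :: real and c a :: "nat \<Rightarrow> real"
  assumes "\<epsilon> \<in> {1, -1}"
    and "N \<ge> 1"
    and "p < N"
    and "\<And>k. k < N \<Longrightarrow> c k = (if \<epsilon> = 1 then real k else real k + 1 / 2)"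
    and "\<And>k. k < N \<Longrightarrow> a k = sin (2 * pi / real N * c k)"
  shows "(\<lambda>m. \<epsilon> ^ m * Bessel_J (N * m + p) x) sums
    ((if p = 0 then 1 else 0) / 2 * Bessel_J 0 x
      + 1 / (2 * real N) *
        (\<Sum>k<N. cos (2 * pi / real N * real p * c k - x * a k)
          + cos (2 * pi / real N * c k) *
            (Lipschitz_Hankel_Jc0 (a k) x * cos (2 * pi / real N * real p * c k - x * a k)
             + Lipschitz_Hankel_Js0 (a k) x * sin (x * a k - 2 * pi / real N * real p * c k))))"
proof -
  define \<theta> where "\<theta> k = 2 * pi / real N * c k" for k
  have \<theta>: "\<theta> k = 2 * pi / real N * (if \<epsilon> = 1 then real k else real k + 1 / 2)" if "k < N" for k
    using assms(4)[OF that] by (simp add: \<theta>_def)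
  have a: "a k = sin (\<theta> k)" if "k < N" for k
    using assms(5)[OF that] by (simp add: \<theta>_def)
  have p\<theta>: "2 * pi / real N * real p * c k = real p * \<theta> k" for k
    by (simp add: \<theta>_def)
  note roots = sum_cos_roots[OF assms(1-3) \<theta>]
  \<comment> \<open>For \<open>p \<noteq> 0\<close> this is the averaging filter at index 0, which
    lies outside the progression \<open>N * m + p\<close>.\<close>
  have sum_p: "(\<Sum>k<N. cos (real p * \<theta> k)) = real N * (if p = 0 then 1 else 0)"
  proof (cases "p = 0")
    case False
    then have "0 \<notin> range (\<lambda>m. N * m + p)" by auto
    from roots(1)[OF _ this] False show ?thesis by simp
  qed simp
  \<comment> \<open>The filter weight: \<open>\<epsilon> ^ m\<close> at
    \<open>n = N * m + p\<close>, and 0 at every other index.\<close>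
  define w where "w n = 1 / real N * (\<Sum>k<N. cos (real n * \<theta> k - real p * \<theta> k))" for n
  have "(\<lambda>n. Bessel_J n x * w n) = (\<lambda>n. 1 / real N *
      (\<Sum>k<N. Bessel_J n x * cos (real n * \<theta> k - real p * \<theta> k)))"
    by (simp add: w_def sum_distrib_left mult_ac)
  also have "\<dots> sums (1 / real N *
      (\<Sum>k<N. Bessel_J 0 x * cos (real p * \<theta> k) / 2 + Bessel_series (\<theta> k) (real p * \<theta> k) x))"
    by (intro sums_mult sums_sum Bessel_J_cos_sums)
  \<comment> \<open>Dropping the indices of weight 0 turns the series over all orders into one over
    the progression, with the same sum.\<close>
  finally have "(\<lambda>m. Bessel_J (N * m + p) x * w (N * m + p)) sums (1 / real N *
      (\<Sum>k<N. Bessel_J 0 x * cos (real p * \<theta> k) / 2 + Bessel_series (\<theta> k) (real p * \<theta> k) x))"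
    using assms(2) roots(1)
    by (subst sums_mono_reindex[where f = "\<lambda>n. Bessel_J n x * w n" and g = "\<lambda>m. N * m + p"])
      (auto simp: strict_mono_def w_def)
  moreover have "w (N * m + p) = \<epsilon> ^ m" for m
    unfolding w_def using roots(2)[of m] assms(2) by simp
  moreover have "1 / real N *
      (\<Sum>k<N. Bessel_J 0 x * cos (real p * \<theta> k) / 2 + Bessel_series (\<theta> k) (real p * \<theta> k) x) =
      (if p = 0 then 1 else 0) / 2 * Bessel_J 0 x
        + 1 / real N * (\<Sum>k<N. Bessel_series (\<theta> k) (real p * \<theta> k) x)"
    using assms(2) sum_p
    by (simp add: sum.distrib distrib_left flip: sum_distrib_left sum_divide_distrib)
  ultimately have "(\<lambda>m. \<epsilon> ^ m * Bessel_J (N * m + p) x) sums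
      ((if p = 0 then 1 else 0) / 2 * Bessel_J 0 x
        + 1 / real N * (\<Sum>k<N. Bessel_series (\<theta> k) (real p * \<theta> k) x))"
    by (simp add: mult.commute)
  moreover have "1 / real N * (\<Sum>k<N. Bessel_series (\<theta> k) (real p * \<theta> k) x) =
      1 / (2 * real N) *
        (\<Sum>k<N. cos (2 * pi / real N * real p * c k - x * a k)
          + cos (2 * pi / real N * c k) *
            (Lipschitz_Hankel_Jc0 (a k) x * cos (2 * pi / real N * real p * c k - x * a k)
             + Lipschitz_Hankel_Js0 (a k) x * sin (x * a k - 2 * pi / real N * real p * c k)))"
    unfolding Bessel_series_closed_form p\<theta> \<theta>_def[symmetric] sum_distrib_left
    by (intro sum.cong refl) (simp add: a)
  ultimately show ?thesis by metis
qed

end
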